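(* Let $T\ge 1$ be the number of global rounds and let the learning rate be $\eta=\frac{1}{3\sqrt{T}L}$. Consider an arbitrary round $t$ of FedDrop starting from the parameter vector $\boldsymbol{w}^{(t)}\in\mathbb{R}^d$, with dropout rates $\gamma_{k,t}\in[0,1)$, $k=1,\dots,K$, and update $$\boldsymbol{w}^{(t+1)}=\boldsymbol{w}^{(t)}-\eta\sum_{k=1}^K\frac{|\mathcal{D}_k|}{|\mathcal{D}|}\hat{\boldsymbol{g}}_k(\hat{\boldsymbol{w}}_k^{(t)}).$$ Assume: (i) $\|\boldsymbol{H}(\boldsymbol{w})\|_F^2\le A^2$ for all $\boldsymbol{w}$; (ii) $\|\boldsymbol{w}^{(t)}\|^2\le G^2$; (iii) $\mathcal{F}(\boldsymbol{w})\ge\mathcal{F}^*$ for all $\boldsymbol{w}$; (iv) $\mathcal{F}$ is $L$-smooth, i.e. $\mathcal{F}(\boldsymbol{v})\le\mathcal{F}(\boldsymbol{w})+(\boldsymbol{v}-\boldsymbol{w})^\top\nabla\mathcal{F}(\boldsymbol{w})+\frac{L}{2}\|\boldsymbol{v}-\boldsymbol{w}\|^2$ for all $\boldsymbol{v},\boldsymbol{w}$, with $L>0$; (v) the stochastic gradients $\tilde{\boldsymbol{g}}_k(\boldsymbol{w})$, $k=1,\dots,K$, are independent, with $\mathbb{E}[\tilde{\boldsymbol{g}}_k(\boldsymbol{w})]=\boldsymbol{g}(\boldsymbol{w})$ and $\mathbb{E}[\|\tilde{\boldsymbol{g}}_k(\boldsymbol{w})-\boldsymbol{g}(\boldsymbol{w})\|^2]\le\frac{\sigma^2}{|\mathcal{D}_k|}$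 for all $k$. Then $$\mathbb{E}\left[\mathcal{F}(\boldsymbol{w}^{(t+1)})-\mathcal{F}(\boldsymbol{w}^{(t)})\right]\le\left(-\frac{1}{3\sqrt{T}L}+\frac{2}{9TL}\right)\|\boldsymbol{g}(\boldsymbol{w}^{(t)})\|^2+\frac{2K}{9TL}\frac{\sigma^2}{|\mathcal{D}|}+\frac{A^2G^2}{9TL}\sum_{k=1}^K\frac{|\mathcal{D}_k|}{|\mathcal{D}|}\cdot\frac{\gamma_{k,t}}{1-\gamma_{k,t}}.$$
   Context: There are $K$ devices; device $k$ has a local dataset of size $|\mathcal{D}_k|\geq 1$ and $|\mathcal{D}|=\sum_{k=1}^K|\mathcal{D}_k|$. $\mathcal{F}:\mathbb{R}^d\to\mathbb{R}$ is the (twice differentiable) global loss function, $\boldsymbol{g}(\boldsymbol{w})=\nabla\mathcal{F}(\boldsymbol{w})$ its ground-truth gradient, and $\boldsymbol{H}(\boldsymbol{w})$ its Hessian. $\sigma^2$ is the per-sample gradient variance. $\|\cdot\|$ is the Euclidean norm, $\|\cdot\|_F$ the Frobenius norm, $\circ$ the element-wise product. Dropout: the subnet of device $k$ in round $t$ is $\hat{\boldsymbol{w}}_k^{(t)}=\boldsymbol{w}^{(t)}\circ\boldsymbol{m}_k^{(t)}$, where each entry of the random mask $\boldsymbol{m}_k^{(t)}\in\mathbb{R}^d$ equals $\frac{1}{1-\gamma_{k,t}}$ with probability $1-\gamma_{k,t}$ and $0$ with probability $\gamma_{k,t}$; masks are independent of the stochastic gradients. $\tilde{\boldsymbol{g}}_k(\boldsymbol{w}^{(t)})$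 is the stochastic gradient of the full network at device $k$, and the subnet's gradient vector is given by its first-order Taylor expansion $$\hat{\boldsymbol{g}}_k(\hat{\boldsymbol{w}}_k^{(t)})=\tilde{\boldsymbol{g}}_k(\boldsymbol{w}^{(t)})+\boldsymbol{H}(\boldsymbol{w}^{(t)})(\hat{\boldsymbol{w}}_k^{(t)}-\boldsymbol{w}^{(t)}).$$ The vector $\boldsymbol{w}^{(t)}$ is given (fixed), and $\mathbb{E}$ is the expectation over the masks and the stochastic gradients of round $t$. *)

theory Defs
  imports "HOL-Probability.Probability"
begin

definition frobenius_norm :: "real^'n^'m \<Rightarrow> real" where
  "frobenius_norm B = sqrt (\<Sum>i\<in>UNIV. \<Sum>j\<in>UNIV. (B $ i $ j)\<^sup>2)"

text \<open>Only the law of each single entry is prescribed; the entries of a mask may depend on each other.\<close>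

definition dropout_mask :: "'a measure \<Rightarrow> real \<Rightarrow> ('a \<Rightarrow> real^'d) \<Rightarrow> bool" where
  "dropout_mask M \<gamma> m \<longleftrightarrow>
     m \<in> borel_measurable M \<and>
     (\<forall>i. measure M {\<omega> \<in> space M. m \<omega> $ i = 1 / (1 - \<gamma>)} = 1 - \<gamma> \<and>
          measure M {\<omega> \<in> space M. m \<omega> $ i = 0} = \<gamma>)"

definition subnet :: "real^'d \<Rightarrow> real^'d \<Rightarrow> real^'d" where
  "subnet w m = (\<chi> i. w $ i * m $ i)"

text \<open>First-order Taylor expansion around the full network \<open>w\<close>: \<open>gt\<close> is the stochastic
  gradient and \<open>B\<close> the Hessian, both taken at \<open>w\<close>.\<close>

definition subnet_gradient :: "real^'d \<Rightarrow> real^'d^'d \<Rightarrow> real^'d \<Rightarrow> real^'d \<Rightarrow> real^'d" where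
  "subnet_gradient gt B w m = gt + B *v (subnet w m - w)"

text \<open>One round from \<open>w\<close> with \<open>K\<close> devices and learning rate \<open>\<eta>\<close>; \<open>D k\<close> is the size of the
  dataset of device \<open>k\<close>, \<open>gh k\<close> the gradient it reports.\<close>

definition feddrop_update ::
  "nat \<Rightarrow> (nat \<Rightarrow> nat) \<Rightarrow> real \<Rightarrow> real^'d \<Rightarrow> (nat \<Rightarrow> real^'d) \<Rightarrow> real^'d" where
  "feddrop_update K D \<eta> w gh =
     w - \<eta> *\<^sub>R (\<Sum>k=1..K. (real (D k) / real (\<Sum>j=1..K. D j)) *\<^sub>R gh k)"

end

theory Submission
  imports Defs
begin

text \<open>Smoothness bounds \<open>F (wnext \<omega>) - F w\<close> by a linear term plus \<open>L * \<eta>\<^sup>2 / 2\<close> times the squared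
  length of the aggregated gradient. By convexity of the squared norm, the latter is at most the
  weighted average of the squared lengths \<open>\<parallel>g + u\<^sub>k + H z\<^sub>k\<parallel>\<^sup>2\<close>, with \<open>u\<^sub>k\<close> the gradient noise and
  \<open>z\<^sub>k\<close> the dropout perturbation of device \<open>k\<close>, and
  \<open>\<parallel>g + u + H z\<parallel>\<^sup>2 \<le> 2 \<parallel>g + u\<parallel>\<^sup>2 + 2 \<parallel>H z\<parallel>\<^sup>2\<close>. Both \<open>u\<^sub>k\<close> and \<open>z\<^sub>k\<close> have mean zero, and a mask entry
  has variance \<open>\<gamma> / (1 - \<gamma>)\<close>. Since the weights are proportional to the sizes of the datasets, the
  weighted sum of the variances \<open>\<sigma>\<^sup>2 / D k\<close> is \<open>K\<close> times \<open>\<sigma>\<^sup>2\<close> over the total size, whence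
  the factor \<open>K\<close> of the bound.\<close>

text \<open>The two prescribed events are disjoint, since \<open>1 / (1 - \<gamma>)\<close> is not
  0, and their probabilities add up to 1. Hence \<open>f\<close> of the entry agrees almost
  everywhere with a combination of two indicators.\<close>

lemma has_bochner_integral_dropout_mask_entry:
  fixes m :: "'a \<Rightarrow> real^'d" and f :: "real \<Rightarrow> real"
  assumes "prob_space M" "dropout_mask M \<gamma> m" "\<gamma> < 1" and f: "f \<in> borel_measurable borel"
  shows "has_bochner_integral M (\<lambda>\<omega>. f (m \<omega> $ i)) ((1 - \<gamma>) * f (1 / (1 - \<gamma>)) + \<gamma> * f 0)"
proof -
  interpret prob_space M by fact
  have m[measurable]: "m \<in> borel_measurable M"
    and pa: "prob {\<omega> \<in> space M. m \<omega> $ i = 1 / (1 - \<gamma>)} = 1 - \<gamma>"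
    and p0: "prob {\<omega> \<in> space M. m \<omega> $ i = 0} = \<gamma>"
    using assms(2) by (auto simp: dropout_mask_def)
  have mi[measurable]: "(\<lambda>\<omega>. m \<omega> $ i) \<in> borel_measurable M"
    by (rule measurable_compose[OF m borel_measurable_continuous_onI])
      (intro continuous_intros)
  define A where "A = {\<omega> \<in> space M. m \<omega> $ i = 1 / (1 - \<gamma>)}"
  define B where "B = {\<omega> \<in> space M. m \<omega> $ i = 0}"
  have [measurable]: "A \<in> sets M" "B \<in> sets M"
    unfolding A_def B_def by measurable
  have disj: "A \<inter> B = {}"
    using \<open>\<gamma> < 1\<close> by (auto simp: A_def B_def)
  have "prob (A \<union> B) = 1"
    using finite_measure_Union[OF _ _ disj] pa p0 by (simp add: A_def[symmetric] B_def[symmetric])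
  then have AE: "AE \<omega> in M. \<omega> \<in> A \<union> B"
    by (subst prob_eq_1[symmetric]) auto
  have "has_bochner_integral M (\<lambda>\<omega>. f (1 / (1 - \<gamma>)) * indicator A \<omega> + f 0 * indicator B \<omega>)
      (f (1 / (1 - \<gamma>)) * prob A + f 0 * prob B)"
    by (intro has_bochner_integral_add has_bochner_integral_mult_right
        has_bochner_integral_real_indicator) (auto simp: less_top[symmetric])
  then have "has_bochner_integral M (\<lambda>\<omega>. f (m \<omega> $ i)) (f (1 / (1 - \<gamma>)) * prob A + f 0 * prob B)"
  proof (rule has_bochner_integralI_AE)
    show "(\<lambda>\<omega>. f (m \<omega> $ i)) \<in> borel_measurable M"
      using measurable_compose[OF mi f] .
    show "AE \<omega> in M. f (1 / (1 - \<gamma>)) * indicator A \<omega> + f 0 * indicator B \<omega> = f (m \<omega> $ i)"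
      using AE by eventually_elim (use \<open>\<gamma> < 1\<close> in \<open>auto simp: A_def B_def indicator_def\<close>)
  qed
  then show ?thesis
    using pa p0 by (simp add: A_def B_def mult.commute)
qed

text \<open>Cauchy-Schwarz on each row of \<open>B\<close>, summed over the rows. The gain is that
  the square of \<open>norm x\<close> is a sum of squares of single entries, whereas the left side
  contains products of different entries.\<close>

lemma norm_matrix_vector_mult_le_frobenius:
  fixes B :: "real^'n^'m"
  shows "(norm (B *v x))\<^sup>2 \<le> (frobenius_norm B)\<^sup>2 * (norm x)\<^sup>2"
proof -
  have "(norm (B *v x))\<^sup>2 = (\<Sum>i\<in>UNIV. ((B $ i) \<bullet> x)\<^sup>2)"
    by (simp add: norm_vec_def L2_set_def sum_nonneg matrix_vector_mul_component)
  also have "\<dots> \<le> (\<Sum>i\<in>UNIV. (norm (B $ i))\<^sup>2 * (norm x)\<^sup>2)"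
    by (intro sum_mono) (metis Cauchy_Schwarz_ineq power2_norm_eq_inner)
  also have "\<dots> = (frobenius_norm B)\<^sup>2 * (norm x)\<^sup>2"
    by (simp add: frobenius_norm_def norm_vec_def L2_set_def sum_nonneg sum_distrib_right)
  finally show ?thesis .
qed

text \<open>The weighted variance of the points around their weighted mean \<open>c\<close> is
  nonnegative; expanding it gives the right side minus the square of \<open>norm c\<close>.\<close>

lemma norm_convex_sum_power2_le:
  fixes x :: "'b \<Rightarrow> 'a::real_inner"
  assumes "\<And>i. i \<in> S \<Longrightarrow> p i \<ge> 0" "sum p S = 1"
  shows "(norm (\<Sum>i\<in>S. p i *\<^sub>R x i))\<^sup>2 \<le> (\<Sum>i\<in>S. p i * (norm (x i))\<^sup>2)"
proof -
  define c where "c = (\<Sum>i\<in>S. p i *\<^sub>R x i)"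
  have sum_c: "(\<Sum>i\<in>S. p i * (x i \<bullet> c)) = c \<bullet> c"
    by (simp only: c_def inner_sum_left inner_scaleR_left)
  have "0 \<le> (\<Sum>i\<in>S. p i * (norm (x i - c))\<^sup>2)"
    using assms by (intro sum_nonneg) auto
  also have "\<dots> = (\<Sum>i\<in>S. p i * (norm (x i))\<^sup>2 - 2 * ((p i *\<^sub>R x i) \<bullet> c) + p i * (c \<bullet> c))"
    by (intro sum.cong refl)
      (simp add: power2_norm_eq_inner inner_diff inner_commute algebra_simps)
  also have "\<dots> = (\<Sum>i\<in>S. p i * (norm (x i))\<^sup>2) - 2 * (c \<bullet> c) + sum p S * (c \<bullet> c)"
    by (simp add: sum.distrib sum_subtractf sum_c flip: sum_distrib_left sum_distrib_right)
  also have "\<dots> = (\<Sum>i\<in>S. p i * (norm (x i))\<^sup>2) - (norm c)\<^sup>2"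
    using assms by (simp add: power2_norm_eq_inner)
  finally show ?thesis
    by (simp add: c_def)
qed

theorem lemma2:
  fixes M :: "'a measure"
    and F :: "real^'d \<Rightarrow> real"
    and g :: "real^'d \<Rightarrow> real^'d"
    and H :: "real^'d \<Rightarrow> real^'d^'d"
    and gt :: "nat \<Rightarrow> real^'d \<Rightarrow> 'a \<Rightarrow> real^'d"
    and m :: "nat \<Rightarrow> 'a \<Rightarrow> real^'d"
    and K T :: nat
    and D :: "nat \<Rightarrow> nat"
    and \<gamma> :: "nat \<Rightarrow> real"
    and w :: "real^'d"
    and wnext :: "'a \<Rightarrow> real^'d"
    and A G L \<sigma> \<eta> Fstar :: real
  assumes prob: "prob_space M"
    and K: "K \<ge> 1"
    and T: "T \<ge> 1"
    and D: "\<And>k. k \<in> {1..K} \<Longrightarrow> D k \<ge> 1"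
    and gradient: "\<And>v. GDERIV F v :> g v"
    and hessian: "\<And>v. (g has_derivative (\<lambda>h. H v *v h)) (at v)"
    and \<gamma>: "\<And>k. k \<in> {1..K} \<Longrightarrow> 0 \<le> \<gamma> k \<and> \<gamma> k < 1"
    and mask: "\<And>k. k \<in> {1..K} \<Longrightarrow> dropout_mask M (\<gamma> k) (m k)"
    and mask_indep: "\<And>v. prob_space.indep_var M
          (PiM {1..K} (\<lambda>_. borel)) (\<lambda>\<omega>. \<lambda>k\<in>{1..K}. m k \<omega>)
          (PiM {1..K} (\<lambda>_. borel)) (\<lambda>\<omega>. \<lambda>k\<in>{1..K}. gt k v \<omega>)"
    and eta: "\<eta> = 1 / (3 * sqrt (real T) * L)"
    and wnext: "\<And>\<omega>. wnext \<omega> =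
          feddrop_update K D \<eta> w (\<lambda>k. subnet_gradient (gt k w \<omega>) (H w) w (m k \<omega>))"
    and hessian_bound: "\<And>v. (frobenius_norm (H v))\<^sup>2 \<le> A\<^sup>2"
    and w_bound: "(norm w)\<^sup>2 \<le> G\<^sup>2"
    and F_lower: "\<And>v. F v \<ge> Fstar"
    and L_pos: "L > 0"
    and smooth: "\<And>u v. F u \<le> F v + (u - v) \<bullet> g v + L / 2 * (norm (u - v))\<^sup>2"
    and gt_indep: "\<And>v. prob_space.indep_vars M (\<lambda>_. borel) (\<lambda>k. gt k v) {1..K}"
    and gt_integrable: "\<And>k v. k \<in> {1..K} \<Longrightarrow> integrable M (gt k v)"
    and gt_mean: "\<And>k v. k \<in> {1..K} \<Longrightarrow> (\<integral>\<omega>. gt k v \<omega> \<partial>M) = g v"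
    and gt_var_integrable:
      "\<And>k v. k \<in> {1..K} \<Longrightarrow> integrable M (\<lambda>\<omega>. (norm (gt k v \<omega> - g v))\<^sup>2)"
    and gt_var:
      "\<And>k v. k \<in> {1..K} \<Longrightarrow> (\<integral>\<omega>. (norm (gt k v \<omega> - g v))\<^sup>2 \<partial>M) \<le> \<sigma>\<^sup>2 / real (D k)"
  shows "integrable M (\<lambda>\<omega>. F (wnext \<omega>) - F w) \<and>
    (\<integral>\<omega>. (F (wnext \<omega>) - F w) \<partial>M)
      \<le> (- 1 / (3 * sqrt (real T) * L) + 2 / (9 * real T * L)) * (norm (g w))\<^sup>2
        + (2 * real K) / (9 * real T * L) * (\<sigma>\<^sup>2 / real (\<Sum>j=1..K. D j))
        + A\<^sup>2 * G\<^sup>2 / (9 * real T * L)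
          * (\<Sum>k=1..K. real (D k) / real (\<Sum>j=1..K. D j) * (\<gamma> k / (1 - \<gamma> k)))"
proof -
  interpret prob_space M by fact
  define N where "N = real (\<Sum>j=1..K. D j)"
  define p where "p k = real (D k) / N" for k
  define u where "u k \<omega> = gt k w \<omega> - g w" for k \<omega>
  define z where "z k \<omega> = subnet w (m k \<omega>) - w" for k \<omega>
  \<comment> \<open>Moving \<open>H w\<close> to the other factor of the inner product turns the
    linear dropout term into a combination of single mask entries.\<close>
  define c where "c = g w v* H w"
  define \<kappa> where "\<kappa> = L * \<eta>\<^sup>2 / 2"
  define V where "V k = (\<integral>\<omega>. (norm (u k \<omega>))\<^sup>2 \<partial>M)" for k
  \<comment> \<open>This is the gradient reported by device \<open>k\<close>, since
    \<open>g w + u k \<omega>\<close> is its stochastic gradient.\<close>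
  define b where "b k \<omega> = g w + u k \<omega> + H w *v z k \<omega>" for k \<omega>
  \<comment> \<open>A pointwise majorant for the contribution of device \<open>k\<close>, arranged
    so that each random term depends either on the noise alone or on a single mask entry. All of
    these have integrals at hand.\<close>
  define R where "R k \<omega> = - \<eta> * ((norm (g w))\<^sup>2 + g w \<bullet> u k \<omega> + (\<Sum>i\<in>UNIV. c $ i * w $ i * (m k \<omega> $ i - 1)))
     + \<kappa> * (2 * (norm (g w))\<^sup>2 + 4 * (g w \<bullet> u k \<omega>) + 2 * (norm (u k \<omega>))\<^sup>2
        + 2 * A\<^sup>2 * (\<Sum>i\<in>UNIV. (w $ i)\<^sup>2 * (m k \<omega> $ i - 1)\<^sup>2))" for k \<omega>
  have N: "N > 0"
    unfolding N_def of_nat_sum using K D by (intro sum_pos) (auto simp: Suc_le_eq)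
  have p_nonneg: "p k \<ge> 0" for k
    using N by (simp add: p_def)
  have p_sum: "(\<Sum>k=1..K. p k) = 1"
    using N by (simp add: p_def N_def flip: sum_divide_distrib)
  have \<kappa>: "\<kappa> = 1 / (18 * real T * L)"
    using L_pos T by (simp add: \<kappa>_def eta power_divide power_mult_distrib field_simps power2_eq_square)
  then have \<kappa>_nonneg: "\<kappa> \<ge> 0"
    using L_pos by simp
  have z_nth: "z k \<omega> $ i = w $ i * (m k \<omega> $ i - 1)" for k \<omega> i
    by (simp add: z_def subnet_def algebra_simps)

  have step: "wnext \<omega> - w = - \<eta> *\<^sub>R (\<Sum>k=1..K. p k *\<^sub>R b k \<omega>)" for \<omega>
    by (simp add: wnext feddrop_update_def subnet_gradient_def b_def u_def z_def p_def N_def)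

  have pointwise: "F (wnext \<omega>) - F w \<le> (\<Sum>k=1..K. p k * R k \<omega>)" for \<omega>
  proof -
    have "F (wnext \<omega>) - F w \<le> (wnext \<omega> - w) \<bullet> g w + L / 2 * (norm (wnext \<omega> - w))\<^sup>2"
      using smooth[of "wnext \<omega>" w] by simp
    also have "\<dots> = - \<eta> * (\<Sum>k=1..K. p k * (g w \<bullet> b k \<omega>)) + \<kappa> * (norm (\<Sum>k=1..K. p k *\<^sub>R b k \<omega>))\<^sup>2"
      unfolding step \<kappa>_def by (simp add: power_mult_distrib inner_sum_left inner_commute[of "g w"])
    also have "\<dots> \<le> - \<eta> * (\<Sum>k=1..K. p k * (g w \<bullet> b k \<omega>)) + \<kappa> * (\<Sum>k=1..K. p k * (norm (b k \<omega>))\<^sup>2)"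
      using \<kappa>_nonneg p_nonneg p_sum
      by (intro add_left_mono mult_left_mono norm_convex_sum_power2_le) auto
    also have "\<dots> = (\<Sum>k=1..K. p k * (- \<eta> * (g w \<bullet> b k \<omega>) + \<kappa> * (norm (b k \<omega>))\<^sup>2))"
      by (simp add: sum_distrib_left sum.distrib sum_subtractf sum_negf algebra_simps)
    also have "\<dots> \<le> (\<Sum>k=1..K. p k * R k \<omega>)"
    proof (intro sum_mono mult_left_mono p_nonneg)
      fix k
      have lin: "g w \<bullet> b k \<omega> = (norm (g w))\<^sup>2 + g w \<bullet> u k \<omega> + (\<Sum>i\<in>UNIV. c $ i * w $ i * (m k \<omega> $ i - 1))"
      proof -
        have "g w \<bullet> (H w *v z k \<omega>) = (\<Sum>i\<in>UNIV. c $ i * w $ i * (m k \<omega> $ i - 1))"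
          unfolding dot_lmul_matrix[symmetric] c_def[symmetric]
          by (simp add: inner_vec_def z_nth mult.assoc)
        then show ?thesis
          by (simp add: b_def inner_add_right power2_norm_eq_inner)
      qed
      have z2: "(norm (z k \<omega>))\<^sup>2 = (\<Sum>i\<in>UNIV. (w $ i)\<^sup>2 * (m k \<omega> $ i - 1)\<^sup>2)"
        by (simp add: norm_vec_def L2_set_def sum_nonneg z_nth power_mult_distrib)
      \<comment> \<open>The parallelogram law. Dropping the second square removes the mixed terms of
        stochastic gradient and dropout pointwise, at the price of a factor 2.\<close>
      have "(norm (b k \<omega>))\<^sup>2 + (norm (g w + u k \<omega> - H w *v z k \<omega>))\<^sup>2
          = 2 * (norm (g w + u k \<omega>))\<^sup>2 + 2 * (norm (H w *v z k \<omega>))\<^sup>2"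
        by (simp add: b_def power2_norm_eq_inner inner_add inner_diff inner_commute)
      then have "(norm (b k \<omega>))\<^sup>2 \<le> 2 * (norm (g w + u k \<omega>))\<^sup>2 + 2 * (norm (H w *v z k \<omega>))\<^sup>2"
        by (smt (verit) zero_le_power2)
      \<comment> \<open>This square is expanded exactly, because its mixed term vanishes in
        expectation.\<close>
      also have "(norm (g w + u k \<omega>))\<^sup>2 = (norm (g w))\<^sup>2 + 2 * (g w \<bullet> u k \<omega>) + (norm (u k \<omega>))\<^sup>2"
        by (simp add: power2_norm_eq_inner inner_add inner_commute)
      also have "(norm (H w *v z k \<omega>))\<^sup>2 \<le> A\<^sup>2 * (norm (z k \<omega>))\<^sup>2"
        by (rule order_trans[OF norm_matrix_vector_mult_le_frobenius])
          (intro mult_right_mono hessian_bound, simp)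
      finally have "\<kappa> * (norm (b k \<omega>))\<^sup>2 \<le> \<kappa> * (2 * (norm (g w))\<^sup>2 + 4 * (g w \<bullet> u k \<omega>)
          + 2 * (norm (u k \<omega>))\<^sup>2 + 2 * A\<^sup>2 * (norm (z k \<omega>))\<^sup>2)"
        using \<kappa>_nonneg by (intro mult_left_mono) auto
      then show "- \<eta> * (g w \<bullet> b k \<omega>) + \<kappa> * (norm (b k \<omega>))\<^sup>2 \<le> R k \<omega>"
        unfolding R_def lin z2 by simp
    qed
    finally show ?thesis .
  qed

  have R_integral: "has_bochner_integral M (R k) (- \<eta> * (norm (g w))\<^sup>2
      + \<kappa> * (2 * (norm (g w))\<^sup>2 + 2 * V k + 2 * A\<^sup>2 * (\<gamma> k / (1 - \<gamma> k) * (norm w)\<^sup>2)))"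
    if k: "k \<in> {1..K}" for k
  proof -
    have \<gamma>k: "0 \<le> \<gamma> k" "\<gamma> k < 1"
      using \<gamma>[OF k] by auto
    note mask_entry = has_bochner_integral_dropout_mask_entry[OF prob mask[OF k] \<gamma>k(2)]
    have const: "has_bochner_integral M (\<lambda>_. a) a" for a :: real
      by (simp add: has_bochner_integral_iff prob_space)
    \<comment> \<open>Kept entries are scaled by \<open>1 / (1 - \<gamma> k)\<close>, which is what
      gives a mask entry mean 1.\<close>
    have mean: "has_bochner_integral M (\<lambda>\<omega>. m k \<omega> $ i - 1) 0" for i
    proof -
      have "(1 - \<gamma> k) * (1 / (1 - \<gamma> k) - 1) + \<gamma> k * (0 - 1) = 0"
        using \<gamma>k by (simp add: field_simps)
      then show ?thesis
        using mask_entry[of "\<lambda>x. x - 1" i] by simp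
    qed
    have var: "has_bochner_integral M (\<lambda>\<omega>. (m k \<omega> $ i - 1)\<^sup>2) (\<gamma> k / (1 - \<gamma> k))" for i
    proof -
      have "1 / (1 - \<gamma> k) - 1 = \<gamma> k / (1 - \<gamma> k)"
        using \<gamma>k by (simp add: field_simps)
      then have "(1 - \<gamma> k) * (1 / (1 - \<gamma> k) - 1)\<^sup>2 + \<gamma> k * (0 - 1)\<^sup>2 = \<gamma> k * (\<gamma> k / (1 - \<gamma> k)) + \<gamma> k"
        using \<gamma>k by (simp add: power2_eq_square)
      also have "\<dots> = \<gamma> k / (1 - \<gamma> k)"
        using \<gamma>k by (simp add: field_simps)
      finally have "(1 - \<gamma> k) * (1 / (1 - \<gamma> k) - 1)\<^sup>2 + \<gamma> k * (0 - 1)\<^sup>2 = \<gamma> k / (1 - \<gamma> k)" .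
      then show ?thesis
        using mask_entry[of "\<lambda>x. (x - 1)\<^sup>2" i] by simp
    qed
    have u_int: "integrable M (u k)"
      unfolding u_def using gt_integrable[OF k] by simp
    have u0: "(\<integral>\<omega>. u k \<omega> \<partial>M) = 0"
      unfolding u_def using gt_integrable[OF k] gt_mean[OF k] by (simp add: prob_space)
    have lin: "has_bochner_integral M (\<lambda>\<omega>. g w \<bullet> u k \<omega>) 0"
      using u_int u0 by (simp add: has_bochner_integral_iff)
    have sq: "has_bochner_integral M (\<lambda>\<omega>. (norm (u k \<omega>))\<^sup>2) (V k)"
      unfolding V_def using gt_var_integrable[OF k, of w]
      by (simp add: u_def has_bochner_integral_integrable)
    \<comment> \<open>The vanishing means are written out as zeros, so that the value has the same
      shape as \<open>R k\<close> and the linearity rules apply term by term.\<close>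
    have "has_bochner_integral M (R k) (- \<eta> * ((norm (g w))\<^sup>2 + 0 + (\<Sum>i\<in>UNIV. c $ i * w $ i * 0))
      + \<kappa> * (2 * (norm (g w))\<^sup>2 + 4 * 0 + 2 * V k
          + 2 * A\<^sup>2 * (\<Sum>i\<in>UNIV. (w $ i)\<^sup>2 * (\<gamma> k / (1 - \<gamma> k)))))"
      unfolding R_def
      by (intro has_bochner_integral_add has_bochner_integral_mult_right
          has_bochner_integral_sum const mean var lin sq)
    moreover have "(\<Sum>i\<in>UNIV. (w $ i)\<^sup>2 * (\<gamma> k / (1 - \<gamma> k))) = \<gamma> k / (1 - \<gamma> k) * (norm w)\<^sup>2"
      by (simp add: norm_vec_def L2_set_def sum_nonneg sum_distrib_left sum_divide_distrib mult.commute)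
    ultimately show ?thesis
      by simp
  qed
  define Q where "Q \<omega> = (\<Sum>k=1..K. p k * R k \<omega>)" for \<omega>
  have Q_integral: "has_bochner_integral M Q (\<Sum>k=1..K. p k * (- \<eta> * (norm (g w))\<^sup>2
      + \<kappa> * (2 * (norm (g w))\<^sup>2 + 2 * V k + 2 * A\<^sup>2 * (\<gamma> k / (1 - \<gamma> k) * (norm w)\<^sup>2))))"
    unfolding Q_def
    by (intro has_bochner_integral_sum has_bochner_integral_mult_right R_integral)

  \<comment> \<open>The Bochner integral of a non-integrable function is 0 by convention, so
    integrability is what makes the integral an expectation. The difference lies between
    \<open>Fstar - F w\<close> and \<open>Q \<omega>\<close>, which gives the integrable bound
    below.\<close>
  have integrable: "integrable M (\<lambda>\<omega>. F (wnext \<omega>) - F w)"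
  proof (rule Bochner_Integration.integrable_bound)
    show "integrable M (\<lambda>\<omega>. \<bar>Q \<omega>\<bar> + \<bar>Fstar - F w\<bar>)"
      using Q_integral by (auto simp: has_bochner_integral_iff)
    show "AE \<omega> in M. norm (F (wnext \<omega>) - F w) \<le> norm (\<bar>Q \<omega>\<bar> + \<bar>Fstar - F w\<bar>)"
    proof (rule AE_I2)
      fix \<omega>
      show "norm (F (wnext \<omega>) - F w) \<le> norm (\<bar>Q \<omega>\<bar> + \<bar>Fstar - F w\<bar>)"
        using pointwise[of \<omega>] F_lower[of "wnext \<omega>"] unfolding Q_def[symmetric] by simp
    qed
    have F[measurable]: "F \<in> borel_measurable borel"
      using gradient
      by (intro borel_measurable_continuous_onI continuous_at_imp_continuous_on)
        (auto simp: gderiv_def intro: has_derivative_continuous)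
    have b[measurable]: "b k \<in> borel_measurable M" if k: "k \<in> {1..K}" for k
    proof -
      have [measurable]: "m k \<in> borel_measurable M"
        using mask[OF k] by (simp add: dropout_mask_def)
      have [measurable]: "u k \<in> borel_measurable M"
        using gt_integrable[OF k, of w] unfolding u_def by auto
      \<comment> \<open>The dropout term is a continuous function of the mask, hence measurable; the
        iterate is then measurable through \<open>step\<close>.\<close>
      have cont: "continuous_on UNIV (\<lambda>x. H w *v (subnet w x - w))"
        unfolding subnet_def
        by (intro continuous_intros matrix_vector_mult_linear_continuous_on[THEN continuous_on_compose2, of UNIV]) auto
      have "(\<lambda>\<omega>. H w *v (subnet w (m k \<omega>) - w)) \<in> borel_measurable M"
        by (rule measurable_compose[OF _ borel_measurable_continuous_onI[OF cont]]) simp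
      then show ?thesis
        unfolding b_def z_def by simp
    qed
    have "wnext = (\<lambda>\<omega>. w + - \<eta> *\<^sub>R (\<Sum>k=1..K. p k *\<^sub>R b k \<omega>))"
      using step by (auto simp: algebra_simps)
    then have [measurable]: "wnext \<in> borel_measurable M"
      by simp
    show "(\<lambda>\<omega>. F (wnext \<omega>) - F w) \<in> borel_measurable M"
      by measurable
  qed

  have "(\<integral>\<omega>. (F (wnext \<omega>) - F w) \<partial>M) \<le> (\<integral>\<omega>. Q \<omega> \<partial>M)"
    using integrable Q_integral pointwise[folded Q_def]
    by (intro integral_mono) (auto simp: has_bochner_integral_iff)
  also have "\<dots> = (\<Sum>k=1..K. p k * (- \<eta> * (norm (g w))\<^sup>2
      + \<kappa> * (2 * (norm (g w))\<^sup>2 + 2 * V k + 2 * A\<^sup>2 * (\<gamma> k / (1 - \<gamma> k) * (norm w)\<^sup>2))))"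
    using Q_integral by (rule has_bochner_integral_integral_eq)
  \<comment> \<open>Besides inserting the bounds on variance and on \<open>w\<close>, this loosens
    the factor 2 of the squared gradient and of the variance to 4, which yields the constants of the
    claim.\<close>
  also have "\<dots> \<le> (\<Sum>k=1..K. p k * (- \<eta> * (norm (g w))\<^sup>2
      + \<kappa> * (4 * (norm (g w))\<^sup>2 + 4 * (\<sigma>\<^sup>2 / real (D k)) + 2 * A\<^sup>2 * (\<gamma> k / (1 - \<gamma> k) * G\<^sup>2))))"
  proof (intro sum_mono mult_left_mono add_left_mono add_mono p_nonneg \<kappa>_nonneg w_bound)
    fix k assume k: "k \<in> {1..K}"
    have "0 \<le> V k"
      by (simp add: V_def)
    moreover have "V k \<le> \<sigma>\<^sup>2 / real (D k)"
      using gt_var[OF k, of w] by (simp add: V_def u_def)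
    ultimately show "2 * V k \<le> 4 * (\<sigma>\<^sup>2 / real (D k))"
      by linarith
    show "0 \<le> \<gamma> k / (1 - \<gamma> k)"
      using \<gamma>[OF k] by simp
  qed auto
  also have "\<dots> = (\<Sum>k=1..K. p k * ((- \<eta> + 4 * \<kappa>) * (norm (g w))\<^sup>2) + 4 * \<kappa> * (\<sigma>\<^sup>2 / N)
      + 2 * \<kappa> * A\<^sup>2 * G\<^sup>2 * (p k * (\<gamma> k / (1 - \<gamma> k))))"
  proof (intro sum.cong refl)
    fix k assume k: "k \<in> {1..K}"
    \<comment> \<open>The size of the dataset cancels, so each device adds the same noise term;
      \<open>D k\<close> is positive by assumption.\<close>
    have "p k * (\<sigma>\<^sup>2 / real (D k)) = \<sigma>\<^sup>2 / N"
      using D[OF k] by (simp add: p_def)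
    then show "p k * (- \<eta> * (norm (g w))\<^sup>2
        + \<kappa> * (4 * (norm (g w))\<^sup>2 + 4 * (\<sigma>\<^sup>2 / real (D k)) + 2 * A\<^sup>2 * (\<gamma> k / (1 - \<gamma> k) * G\<^sup>2)))
      = p k * ((- \<eta> + 4 * \<kappa>) * (norm (g w))\<^sup>2) + 4 * \<kappa> * (\<sigma>\<^sup>2 / N)
        + 2 * \<kappa> * A\<^sup>2 * G\<^sup>2 * (p k * (\<gamma> k / (1 - \<gamma> k)))"
      by algebra
  qed
  also have "\<dots> = (- \<eta> + 4 * \<kappa>) * (norm (g w))\<^sup>2 + 4 * \<kappa> * real K * (\<sigma>\<^sup>2 / N)
      + 2 * \<kappa> * A\<^sup>2 * G\<^sup>2 * (\<Sum>k=1..K. p k * (\<gamma> k / (1 - \<gamma> k)))"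
    unfolding sum.distrib sum_distrib_left[symmetric] sum_distrib_right[symmetric] p_sum by simp
  \<comment> \<open>As \<kappa> equals \<open>1 / (18 * real T * L)\<close>, the factor
    \<open>4 * \<kappa>\<close> becomes \<open>2 / (9 * real T * L)\<close> and
    \<open>2 * \<kappa>\<close> becomes \<open>1 / (9 * real T * L)\<close>.\<close>
  also have "\<dots> = (- 1 / (3 * sqrt (real T) * L) + 2 / (9 * real T * L)) * (norm (g w))\<^sup>2
        + (2 * real K) / (9 * real T * L) * (\<sigma>\<^sup>2 / N)
        + A\<^sup>2 * G\<^sup>2 / (9 * real T * L) * (\<Sum>k=1..K. p k * (\<gamma> k / (1 - \<gamma> k)))"
    by (simp add: \<kappa> eta ac_simps)
  finally show ?thesis
    using integrable unfolding p_def N_def by blast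
qed

end
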